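(* Let $M$ be a finite metric space, $n=\#M$. Then for every $m\in\mathbb{N}$ with $m>n$ and every $\lambda>0$ we have $$2d_{GH}(\lambda\Delta_m,M)=\max\{\lambda,\ \operatorname{diam}M-\lambda\}.$$
   Context: $\#M$ is the cardinality of $M$ and $d_{GH}$ is the Gromov--Hausdorff distance. $\lambda\Delta_m$ denotes the $m$-point metric space (simplex) all of whose nonzero distances equal $\lambda$. *)

theory Defs
  imports "HOL-Analysis.Analysis"
begin

(* ennreal rather than real: sup, inf then need no side conditions, and unbounded
   (or empty versus nonempty) sets are at distance infinity. *)
definition hausdorff_dist :: "'a metric \<Rightarrow> 'a set \<Rightarrow> 'a set \<Rightarrow> ennreal" where
  "hausdorff_dist Z A B =
     max (SUP a\<in>A. INF b\<in>B. ennreal (mdist Z a b))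
         (SUP b\<in>B. INF a\<in>A. ennreal (mdist Z a b))"

definition isometric_embedding :: "'a metric \<Rightarrow> 'b metric \<Rightarrow> ('a \<Rightarrow> 'b) \<Rightarrow> bool" where
  "isometric_embedding X Z f \<longleftrightarrow>
     f ` mspace X \<subseteq> mspace Z \<and>
     (\<forall>x\<in>mspace X. \<forall>y\<in>mspace X. mdist Z (f x) (f y) = mdist X x y)"

(* The infimum of the Hausdorff distances of isometric copies of X and Y in a common
   metric space Z.  HOL cannot quantify over the type of the points of Z; the type 'a + 'b
   is large enough, as only the union of the two copies matters.  That spaces Z over
   other types give nothing smaller is gh_dist_le_hausdorff_dist below. *)
definition gh_dist :: "'a metric \<Rightarrow> 'b metric \<Rightarrow> ennreal" where
  "gh_dist X Y =
     Inf {hausdorff_dist Z (f ` mspace X) (g ` mspace Y) | (Z :: ('a + 'b) metric) f g.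
            isometric_embedding X Z f \<and> isometric_embedding Y Z g}"

lemma gh_dist_le_hausdorff_dist:
  fixes X :: "'a metric" and Y :: "'b metric" and Z :: "'c metric"
  assumes f: "isometric_embedding X Z f" and g: "isometric_embedding Y Z g"
  shows "gh_dist X Y \<le> hausdorff_dist Z (f ` mspace X) (g ` mspace Y)"
proof -
  let ?A = "f ` mspace X" and ?B = "g ` mspace Y"
  define h :: "'c \<Rightarrow> 'a + 'b" where
    "h = (\<lambda>z. if z \<in> ?A then Inl (inv_into (mspace X) f z) else Inr (inv_into (mspace Y) g z))"
  have inj: "inj_on h (?A \<union> ?B)"
    by (auto simp: inj_on_def h_def split: if_splits dest: inv_into_injective)
  define k where "k = inv_into (?A \<union> ?B) h"
  have kh: "k (h z) = z" if "z \<in> ?A \<union> ?B" for z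
    using that inj by (simp add: k_def inv_into_f_f)
  have sub: "?A \<union> ?B \<subseteq> mspace Z"
    using f g by (auto simp: isometric_embedding_def)
  interpret Z: Metric_space "mspace Z" "mdist Z"
    by simp
  have met: "Metric_space (h ` (?A \<union> ?B)) (\<lambda>u v. mdist Z (k u) (k v))"
  proof
    fix u v assume "u \<in> h ` (?A \<union> ?B)" "v \<in> h ` (?A \<union> ?B)"
    then obtain a b where "u = h a" "a \<in> ?A \<union> ?B" "v = h b" "b \<in> ?A \<union> ?B" by blast
    then show "mdist Z (k u) (k v) = 0 \<longleftrightarrow> u = v"
      using kh sub by (metis Z.zero subsetD)
  next
    fix u v w
    assume "u \<in> h ` (?A \<union> ?B)" "v \<in> h ` (?A \<union> ?B)" "w \<in> h ` (?A \<union> ?B)"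
    then have "k u \<in> mspace Z" "k v \<in> mspace Z" "k w \<in> mspace Z"
      using kh sub by auto
    then show "mdist Z (k u) (k w) \<le> mdist Z (k u) (k v) + mdist Z (k v) (k w)"
      by (rule Z.triangle)
  qed (auto simp: Z.commute)
  define W where "W = metric (h ` (?A \<union> ?B), \<lambda>u v. mdist Z (k u) (k v))"
  have W: "mspace W = h ` (?A \<union> ?B)" "mdist W = (\<lambda>u v. mdist Z (k u) (k v))"
    using met by (simp_all add: W_def Metric_space.mspace_metric Metric_space.mdist_metric)
  have hW: "mdist W (h a) (h b) = mdist Z a b" if "a \<in> ?A \<union> ?B" "b \<in> ?A \<union> ?B" for a b
    using that by (simp only: W kh)
  have "isometric_embedding X W (h \<circ> f)" "isometric_embedding Y W (h \<circ> g)"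
    using f g hW by (auto simp: isometric_embedding_def W(1))
  then have "gh_dist X Y \<le> hausdorff_dist W ((h \<circ> f) ` mspace X) ((h \<circ> g) ` mspace Y)"
    unfolding gh_dist_def by (intro Inf_lower) blast
  also have "\<dots> = hausdorff_dist Z ?A ?B"
    unfolding hausdorff_dist_def image_image comp_def
    by (intro arg_cong2[where f = max] SUP_cong INF_cong refl) (auto simp: hW)
  finally show ?thesis .
qed

(* Real-valued, hence meaningful for bounded spaces only (as the library's diameter). *)
definition metric_diam :: "'a metric \<Rightarrow> real" where
  "metric_diam X =
     (if mspace X = {} then 0 else SUP (x, y)\<in>mspace X \<times> mspace X. mdist X x y)"

(* Intended for l > 0; for l < 0 the value of the abstraction map is unspecified. *)
definition simplex_metric :: "real \<Rightarrow> nat \<Rightarrow> nat metric" where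
  "simplex_metric l m = metric ({..<m}, \<lambda>i j. if i = j then 0 else l)"

lemma
  assumes "l > 0"
  shows mspace_simplex_metric: "mspace (simplex_metric l m) = {..<m}"
    and mdist_simplex_metric: "mdist (simplex_metric l m) = (\<lambda>i j. if i = j then 0 else l)"
proof -
  have "Metric_space {..<m} (\<lambda>i j. if i = j then 0 else l)"
    using assms by unfold_locales auto
  then show "mspace (simplex_metric l m) = {..<m}"
    "mdist (simplex_metric l m) = (\<lambda>i j. if i = j then 0 else l)"
    by (simp_all add: simplex_metric_def Metric_space.mspace_metric Metric_space.mdist_metric)
qed

end

theory Submission
  imports Defs
begin

text \<open>
  The proof works with correspondences: relations between two spaces that are total on both
  sides. A correspondence under which distances differ by at most \<open>2 * r\<close> lets the two spaces
  be glued so that related points lie at distance \<open>r\<close> (\<open>gh_dist_le_if_correspondence\<close>).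
  Conversely, if finite spaces sit in a common space at Hausdorff distance at most \<open>r\<close>, then
  being at distance at most \<open>r\<close> is such a correspondence (\<open>correspondence_if_hausdorff_dist_le\<close>).

  Let the simplex have more vertices than \<open>M\<close> has points. By the pigeonhole principle every
  correspondence relates two distinct vertices to one point, where distances differ by the edge
  length \<open>l\<close>. It also relates two points realising the diameter to vertices at distance at most
  \<open>l\<close>, where distances differ by at least \<open>metric_diam M - l\<close>. So \<open>2 * r\<close> is at least the claimed
  maximum. Equality is attained by the graph of any surjection from the vertices onto \<open>M\<close>: one
  vertex gives discrepancy 0, and distinct vertices give \<open>\<bar>l - d\<bar>\<close> for some \<open>d\<close> between 0 and the
  diameter, which never exceeds the maximum.
\<close>

section \<open>Correspondences and the Gromov--Hausdorff distance\<close>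

text \<open>The real \<open>e\<close> is an upper bound for what is usually called the distortion of \<open>R\<close>. A bound
  rather than a supremum keeps the notion meaningful for unbounded discrepancies.\<close>

definition correspondence_within ::
    "real \<Rightarrow> 'a metric \<Rightarrow> 'b metric \<Rightarrow> ('a \<times> 'b) set \<Rightarrow> bool" where
  "correspondence_within e X Y R \<longleftrightarrow>
     R \<subseteq> mspace X \<times> mspace Y \<and>
     (\<forall>x\<in>mspace X. \<exists>y. (x, y) \<in> R) \<and> (\<forall>y\<in>mspace Y. \<exists>x. (x, y) \<in> R) \<and>
     (\<forall>(x, y)\<in>R. \<forall>(x', y')\<in>R. \<bar>mdist X x x' - mdist Y y y'\<bar> \<le> e)"

text \<open>The infimal length of a path from \<open>x\<close> to \<open>y\<close> when each pair in \<open>R\<close> is joined by a bridge of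
  length \<open>r\<close> and a path crosses one bridge only.\<close>

definition bridge_dist :: "real \<Rightarrow> 'a metric \<Rightarrow> 'b metric \<Rightarrow> ('a \<times> 'b) set \<Rightarrow> 'a \<Rightarrow> 'b \<Rightarrow> real" where
  "bridge_dist r X Y R x y = r + (INF (x', y')\<in>R. mdist X x x' + mdist Y y' y)"

fun glued_dist :: "real \<Rightarrow> 'a metric \<Rightarrow> 'b metric \<Rightarrow> ('a \<times> 'b) set \<Rightarrow> 'a + 'b \<Rightarrow> 'a + 'b \<Rightarrow> real" where
  "glued_dist r X Y R (Inl x) (Inl x') = mdist X x x'"
| "glued_dist r X Y R (Inr y) (Inr y') = mdist Y y y'"
| "glued_dist r X Y R (Inl x) (Inr y) = bridge_dist r X Y R x y"
| "glued_dist r X Y R (Inr y) (Inl x) = bridge_dist r X Y R x y"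

lemma bridge_dist_le:
  assumes "(x', y') \<in> R"
  shows "bridge_dist r X Y R x y \<le> r + mdist X x x' + mdist Y y' y"
proof -
  have "bdd_below ((\<lambda>(x', y'). mdist X x x' + mdist Y y' y) ` R)"
    by (rule bdd_belowI[where m = 0]) auto
  from cINF_lower[OF this assms] show ?thesis
    by (simp add: bridge_dist_def)
qed

lemma bridge_dist_greatest:
  assumes "R \<noteq> {}"
    and "\<And>x' y'. (x', y') \<in> R \<Longrightarrow> c \<le> r + mdist X x x' + mdist Y y' y"
  shows "c \<le> bridge_dist r X Y R x y"
proof -
  have "c - r \<le> (INF (x', y')\<in>R. mdist X x x' + mdist Y y' y)"
    using assms by (intro cINF_greatest) (auto simp: algebra_simps)
  then show ?thesis
    by (simp add: bridge_dist_def)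
qed

text \<open>Only a detour over two bridges could violate the triangle inequality. It costs \<open>2 * r\<close>,
  which is the most by which passing to the other space can shorten a distance. The strict
  inequality \<open>r > 0\<close> keeps points of different spaces apart.\<close>

lemma Metric_space_glued_dist:
  assumes R: "correspondence_within (2 * r) X Y R" and ne: "R \<noteq> {}" and "r > 0"
  shows "Metric_space (mspace X <+> mspace Y) (glued_dist r X Y R)"
proof -
  interpret X: Metric_space "mspace X" "mdist X" by simp
  interpret Y: Metric_space "mspace Y" "mdist Y" by simp
  let ?b = "bridge_dist r X Y R"
  have inR: "x \<in> mspace X" "y \<in> mspace Y" if "(x, y) \<in> R" for x y
    using R that by (auto simp: correspondence_within_def)
  have dist: "mdist X x x' \<le> 2 * r + mdist Y y y'" "mdist Y y y' \<le> 2 * r + mdist X x x'"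
    if "(x, y) \<in> R" "(x', y') \<in> R" for x y x' y'
    using R that by (fastforce simp: correspondence_within_def abs_le_iff)+
  have pos: "?b x y > 0" for x y
  proof -
    have "r \<le> ?b x y"
      using ne by (intro bridge_dist_greatest) auto
    with \<open>r > 0\<close> show ?thesis by simp
  qed
  have triX: "?b x y \<le> mdist X x x' + ?b x' y"
    if xy: "x \<in> mspace X" "x' \<in> mspace X" for x x' y
  proof -
    have "?b x y - mdist X x x' \<le> ?b x' y"
    proof (rule bridge_dist_greatest)
      fix p q assume "(p, q) \<in> R"
      with bridge_dist_le[OF this, of r X Y x y] X.triangle[of x x' p] inR xy
      show "?b x y - mdist X x x' \<le> r + mdist X x' p + mdist Y q y"
        by fastforce
    qed (rule ne)
    then show ?thesis by simp
  qed
  have triY: "?b x y \<le> ?b x y' + mdist Y y' y"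
    if xy: "y \<in> mspace Y" "y' \<in> mspace Y" for x y y'
  proof -
    have "?b x y - mdist Y y' y \<le> ?b x y'"
    proof (rule bridge_dist_greatest)
      fix p q assume "(p, q) \<in> R"
      with bridge_dist_le[OF this, of r X Y x y] Y.triangle[of q y' y] inR xy
      show "?b x y - mdist Y y' y \<le> r + mdist X x p + mdist Y q y'"
        by fastforce
    qed (rule ne)
    then show ?thesis by simp
  qed
  have triX': "?b x y \<le> ?b x' y + mdist X x' x" if "x \<in> mspace X" "x' \<in> mspace X" for x x' y
    using triX[OF that, of y] X.commute[of x x'] by simp
  have triY': "?b x y \<le> mdist Y y y' + ?b x y'" if "y \<in> mspace Y" "y' \<in> mspace Y" for x y y'
    using triY[OF that, of x] Y.commute[of y y'] by simp
  have detourX: "mdist X x x' \<le> ?b x y + ?b x' y"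
    if xy: "x \<in> mspace X" "x' \<in> mspace X" "y \<in> mspace Y" for x x' y
  proof -
    have "mdist X x x' - ?b x' y \<le> ?b x y"
    proof (rule bridge_dist_greatest)
      fix p q assume pq: "(p, q) \<in> R"
      have "mdist X x x' - (r + mdist X x p + mdist Y q y) \<le> ?b x' y"
      proof (rule bridge_dist_greatest)
        fix p' q' assume pq': "(p', q') \<in> R"
        have "mdist X x x' \<le> mdist X x p + mdist X p p' + mdist X p' x'"
          using X.triangle[of x p x'] X.triangle[of p p' x'] inR[OF pq] inR[OF pq'] xy by linarith
        moreover have "mdist Y q q' \<le> mdist Y q y + mdist Y q' y"
          using Y.triangle[of q y q'] inR[OF pq] inR[OF pq'] xy Y.commute[of q' y] by simp
        ultimately show "mdist X x x' - (r + mdist X x p + mdist Y q y)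
            \<le> r + mdist X x' p' + mdist Y q' y"
          using dist(1)[OF pq pq'] X.commute[of p' x'] by simp
      qed (rule ne)
      then show "mdist X x x' - ?b x' y \<le> r + mdist X x p + mdist Y q y" by simp
    qed (rule ne)
    then show ?thesis by simp
  qed
  have detourY: "mdist Y y y' \<le> ?b x y + ?b x y'"
    if xy: "y \<in> mspace Y" "y' \<in> mspace Y" "x \<in> mspace X" for x y y'
  proof -
    have "mdist Y y y' - ?b x y' \<le> ?b x y"
    proof (rule bridge_dist_greatest)
      fix p q assume pq: "(p, q) \<in> R"
      have "mdist Y y y' - (r + mdist X x p + mdist Y q y) \<le> ?b x y'"
      proof (rule bridge_dist_greatest)
        fix p' q' assume pq': "(p', q') \<in> R"
        have "mdist Y y y' \<le> mdist Y q y + mdist Y q q' + mdist Y q' y'"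
          using Y.triangle[of y q y'] Y.triangle[of q q' y'] inR[OF pq] inR[OF pq'] xy
            Y.commute[of q y] by simp
        moreover have "mdist X p p' \<le> mdist X x p + mdist X x p'"
          using X.triangle[of p x p'] inR[OF pq] inR[OF pq'] xy X.commute[of p x] by simp
        ultimately show "mdist Y y y' - (r + mdist X x p + mdist Y q y)
            \<le> r + mdist X x p' + mdist Y q' y'"
          using dist(2)[OF pq pq'] by simp
      qed (rule ne)
      then show "mdist Y y y' - ?b x y' \<le> r + mdist X x p + mdist Y q y" by simp
    qed (rule ne)
    then show ?thesis by simp
  qed
  show ?thesis
  proof
    fix u v :: "'a + 'b"
    show "0 \<le> glued_dist r X Y R u v"
      using pos by (cases u; cases v) (auto simp: less_imp_le)
    show "glued_dist r X Y R u v = glued_dist r X Y R v u"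
      by (cases u; cases v) (auto simp: X.commute Y.commute)
  next
    fix u v assume "u \<in> mspace X <+> mspace Y" "v \<in> mspace X <+> mspace Y"
    then show "glued_dist r X Y R u v = 0 \<longleftrightarrow> u = v"
      using pos by (fastforce simp: less_le)
  next
    fix u v w
    assume "u \<in> mspace X <+> mspace Y" "v \<in> mspace X <+> mspace Y" "w \<in> mspace X <+> mspace Y"
    then show "glued_dist r X Y R u w \<le> glued_dist r X Y R u v + glued_dist r X Y R v w"
      using triX triX' triY triY' detourX detourY X.triangle Y.triangle
      by (elim PlusE) auto
  qed
qed

theorem gh_dist_le_if_correspondence:
  assumes R: "correspondence_within (2 * r) X Y R" and "r > 0"
  shows "gh_dist X Y \<le> ennreal r"
proof (cases "R = {}")
  \<comment> \<open>Both spaces are empty here, and gluing would take an infimum over the empty set, whose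
    value in the reals is unspecified.\<close>
  case True
  then have empty: "mspace X = {}" "mspace Y = {}"
    using R by (auto simp: correspondence_within_def)
  then have "isometric_embedding X X id" "isometric_embedding Y X undefined"
    by (auto simp: isometric_embedding_def)
  from gh_dist_le_hausdorff_dist[OF this] show ?thesis
    by (simp add: empty hausdorff_dist_def bot_ennreal)
next
  case False
  let ?d = "glued_dist r X Y R"
  interpret X: Metric_space "mspace X" "mdist X" by simp
  interpret Y: Metric_space "mspace Y" "mdist Y" by simp
  define Z where "Z = metric (mspace X <+> mspace Y, ?d)"
  have Z: "mspace Z = mspace X <+> mspace Y" "mdist Z = ?d"
    using Metric_space_glued_dist[OF R False \<open>r > 0\<close>]
    by (simp_all add: Z_def Metric_space.mspace_metric Metric_space.mdist_metric)
  have close: "?d (Inl x) (Inr y) \<le> r" "?d (Inr y) (Inl x) \<le> r" if "(x, y) \<in> R" for x y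
  proof -
    have "x \<in> mspace X" "y \<in> mspace Y"
      using R that by (auto simp: correspondence_within_def)
    with bridge_dist_le[OF that, of r X Y x y]
    show "?d (Inl x) (Inr y) \<le> r" "?d (Inr y) (Inl x) \<le> r" by auto
  qed
  have emb: "isometric_embedding X Z Inl" "isometric_embedding Y Z Inr"
    by (auto simp: isometric_embedding_def Z)
  have "hausdorff_dist Z (Inl ` mspace X) (Inr ` mspace Y) \<le> ennreal r"
    unfolding hausdorff_dist_def
  proof (intro max.boundedI SUP_least)
    fix a assume "a \<in> (Inl ` mspace X :: ('a + 'b) set)"
    then obtain x y where "a = Inl x" "(x, y) \<in> R" "y \<in> mspace Y"
      using R unfolding correspondence_within_def by blast
    then show "(INF b\<in>Inr ` mspace Y. ennreal (mdist Z a b)) \<le> ennreal r"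
      using close by (intro INF_lower2[of "Inr y"] ennreal_leI) (auto simp: Z)
  next
    fix b assume "b \<in> (Inr ` mspace Y :: ('a + 'b) set)"
    then obtain x y where "b = Inr y" "(x, y) \<in> R" "x \<in> mspace X"
      using R unfolding correspondence_within_def by blast
    then show "(INF a\<in>Inl ` mspace X. ennreal (mdist Z a b)) \<le> ennreal r"
      using close by (intro INF_lower2[of "Inl x"] ennreal_leI) (auto simp: Z)
  qed
  with gh_dist_le_hausdorff_dist[OF emb] show ?thesis by (rule order_trans)
qed

lemma hausdorff_dist_commute: "hausdorff_dist Z A B = hausdorff_dist Z B A"
proof -
  interpret Z: Metric_space "mspace Z" "mdist Z" by simp
  show ?thesis by (simp add: hausdorff_dist_def max.commute Z.commute)
qed

text \<open>Finiteness is what turns the infimum in the Hausdorff distance into a nearest point.\<close>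

lemma near_point_if_hausdorff_dist_le:
  assumes "hausdorff_dist Z A B \<le> ennreal r" "0 \<le> r" "finite B" "B \<noteq> {}" "a \<in> A"
  shows "\<exists>b\<in>B. mdist Z a b \<le> r"
proof -
  have "(INF b\<in>B. ennreal (mdist Z a b)) \<le> hausdorff_dist Z A B"
    unfolding hausdorff_dist_def using \<open>a \<in> A\<close> by (intro max.coboundedI1 SUP_upper)
  then have "(INF b\<in>B. ennreal (mdist Z a b)) \<le> ennreal r"
    using assms(1) by (rule order_trans)
  moreover have "(INF b\<in>B. ennreal (mdist Z a b)) \<in> (\<lambda>b. ennreal (mdist Z a b)) ` B"
    using assms(3,4) Min_in[of "(\<lambda>b. ennreal (mdist Z a b)) ` B"] by (simp add: Min_Inf)
  ultimately show ?thesis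
    using \<open>0 \<le> r\<close> by (auto simp: ennreal_le_iff)
qed

lemma correspondence_if_hausdorff_dist_le:
  assumes f: "isometric_embedding X Z f" and g: "isometric_embedding Y Z g"
    and "finite (mspace X)" "mspace X \<noteq> {}" "finite (mspace Y)" "mspace Y \<noteq> {}"
    and H: "hausdorff_dist Z (f ` mspace X) (g ` mspace Y) \<le> ennreal r" and "0 \<le> r"
  shows "correspondence_within (2 * r) X Y
           {(x, y) \<in> mspace X \<times> mspace Y. mdist Z (f x) (g y) \<le> r}"
proof -
  interpret Z: Metric_space "mspace Z" "mdist Z" by simp
  have "\<exists>y\<in>mspace Y. mdist Z (f x) (g y) \<le> r" if "x \<in> mspace X" for x
    using near_point_if_hausdorff_dist_le[OF H, of "f x"] assms that by auto
  moreover have "\<exists>x\<in>mspace X. mdist Z (f x) (g y) \<le> r" if "y \<in> mspace Y" for y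
    using near_point_if_hausdorff_dist_le[of Z "g ` mspace Y" "f ` mspace X" r "g y"] assms that
    by (auto simp: hausdorff_dist_commute[of Z "g ` mspace Y"] Z.commute)
  moreover have "\<bar>mdist X x x' - mdist Y y y'\<bar> \<le> 2 * r"
    if xy: "x \<in> mspace X" "x' \<in> mspace X" "y \<in> mspace Y" "y' \<in> mspace Y"
      and le: "mdist Z (f x) (g y) \<le> r" "mdist Z (f x') (g y') \<le> r" for x x' y y'
  proof -
    have mem: "f x \<in> mspace Z" "f x' \<in> mspace Z" "g y \<in> mspace Z" "g y' \<in> mspace Z"
      and eq: "mdist X x x' = mdist Z (f x) (f x')" "mdist Y y y' = mdist Z (g y) (g y')"
      using f g xy by (auto simp: isometric_embedding_def)
    have "mdist Z (f x) (f x') \<le> mdist Z (f x) (g y) + mdist Z (g y) (g y') + mdist Z (f x') (g y')"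
      using Z.triangle[of "f x" "g y" "f x'"] Z.triangle[of "g y" "g y'" "f x'"]
        Z.commute[of "g y'" "f x'"] mem by simp
    moreover have
      "mdist Z (g y) (g y') \<le> mdist Z (f x) (g y) + mdist Z (f x) (f x') + mdist Z (f x') (g y')"
      using Z.triangle[of "g y" "f x" "g y'"] Z.triangle[of "f x" "f x'" "g y'"]
        Z.commute[of "g y" "f x"] mem by simp
    ultimately show ?thesis using le eq by linarith
  qed
  ultimately show ?thesis
    unfolding correspondence_within_def by blast
qed

section \<open>Diameters of finite metric spaces\<close>

lemma
  assumes "finite (mspace M)"
  shows mdist_le_metric_diam: "\<lbrakk>x \<in> mspace M; y \<in> mspace M\<rbrakk> \<Longrightarrow> mdist M x y \<le> metric_diam M"
    and metric_diam_attained: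
      "mspace M \<noteq> {} \<Longrightarrow> \<exists>x\<in>mspace M. \<exists>y\<in>mspace M. metric_diam M = mdist M x y"
proof -
  let ?D = "(\<lambda>(x, y). mdist M x y) ` (mspace M \<times> mspace M)"
  have fin: "finite ?D" using assms by blast
  have eq: "metric_diam M = Max ?D" if "mspace M \<noteq> {}"
    using that fin by (simp add: metric_diam_def cSup_eq_Max)
  show "mdist M x y \<le> metric_diam M" if "x \<in> mspace M" "y \<in> mspace M"
  proof -
    have "mdist M x y \<in> ?D" using that by force
    moreover have "metric_diam M = Max ?D" using that by (intro eq) blast
    ultimately show ?thesis using fin by simp
  qed
  show "\<exists>x\<in>mspace M. \<exists>y\<in>mspace M. metric_diam M = mdist M x y" if "mspace M \<noteq> {}"
  proof -
    have "Max ?D \<in> ?D" using that fin by (intro Max_in) auto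
    then show ?thesis using eq[OF that] by auto
  qed
qed

section \<open>Correspondences between a simplex and a smaller space\<close>

text \<open>The two lower bounds: pigeonhole for \<open>l\<close>, and a pair of points realising the diameter for
  the other term.\<close>

lemma simplex_correspondence_lower:
  assumes R: "correspondence_within e (simplex_metric l m) M R"
    and M: "finite (mspace M)" "mspace M \<noteq> {}" "card (mspace M) < m" and "l > 0"
  shows "max l (metric_diam M - l) \<le> e"
proof (rule max.boundedI)
  interpret M: Metric_space "mspace M" "mdist M" by simp
  note simplex = mspace_simplex_metric[OF \<open>l > 0\<close>] mdist_simplex_metric[OF \<open>l > 0\<close>]
  have dist: "\<bar>(if i = j then 0 else l) - mdist M x y\<bar> \<le> e" if "(i, x) \<in> R" "(j, y) \<in> R" for i j x y
    using R that unfolding correspondence_within_def simplex by blast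
  have inM: "x \<in> mspace M" if "(i, x) \<in> R" for i x
    using R that by (auto simp: correspondence_within_def)
  show "l \<le> e"
  proof -
    have "\<forall>i\<in>{..<m}. \<exists>x. (i, x) \<in> R"
      using R by (simp add: correspondence_within_def simplex)
    then obtain h where h: "\<And>i. i < m \<Longrightarrow> (i, h i) \<in> R"
      by (metis lessThan_iff)
    then have "h ` {..<m} \<subseteq> mspace M" using inM by blast
    then have "card (h ` {..<m}) < card {..<m}"
      using M card_mono[of "mspace M" "h ` {..<m}"] by simp
    then have "\<not> inj_on h {..<m}" by (rule pigeonhole)
    then obtain i j where ij: "i < m" "j < m" "i \<noteq> j" "h i = h j"
      by (auto simp: inj_on_def)
    have "mdist M (h i) (h j) = 0"
      using ij inM[OF h, of j] by simp
    then show ?thesis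
      using dist[OF h h, of i j] ij \<open>l > 0\<close> by simp
  qed
  show "metric_diam M - l \<le> e"
  proof -
    obtain x y where xy: "x \<in> mspace M" "y \<in> mspace M" "metric_diam M = mdist M x y"
      using metric_diam_attained M by blast
    then obtain i j where "(i, x) \<in> R" "(j, y) \<in> R"
      using R by (fastforce simp: correspondence_within_def)
    from dist[OF this] \<open>l > 0\<close> xy show ?thesis by (auto split: if_splits)
  qed
qed

lemma simplex_correspondence_surj:
  assumes h: "h ` {..<m} = mspace M" and "finite (mspace M)" and "l > 0"
  shows "correspondence_within (max l (metric_diam M - l)) (simplex_metric l m) M
           ((\<lambda>i. (i, h i)) ` {..<m})"
proof -
  interpret M: Metric_space "mspace M" "mdist M" by simp
  have mem: "h i \<in> mspace M" if "i < m" for i using h that by blast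
  have "\<bar>(if i = j then 0 else l) - mdist M (h i) (h j)\<bar> \<le> max l (metric_diam M - l)"
    if "i < m" "j < m" for i j
  proof (cases "i = j")
    case True
    then show ?thesis using mem[of j] that \<open>l > 0\<close> by simp
  next
    case False
    have "mdist M (h i) (h j) \<le> metric_diam M"
      using \<open>finite (mspace M)\<close> mem that by (intro mdist_le_metric_diam)
    moreover have "0 \<le> mdist M (h i) (h j)" by simp
    ultimately show ?thesis using False by (simp only: if_False)
  qed
  moreover have "\<exists>i<m. x = h i" if "x \<in> mspace M" for x
    using that unfolding h[symmetric] by auto
  ultimately show ?thesis
    using mem unfolding correspondence_within_def
    by (auto simp: mspace_simplex_metric mdist_simplex_metric \<open>l > 0\<close> image_iff)
qed

lemma ex_surj_lessThan:
  assumes "finite A" "A \<noteq> {}" "card A \<le> m"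
  shows "\<exists>h. h ` {..<m} = A"
proof -
  obtain g where g: "inj_on g A" "g ` A \<subseteq> {..<m}"
    using card_le_inj[of A "{..<m}"] assms by auto
  from assms(2) obtain a where a: "a \<in> A" by blast
  have "(\<lambda>i. if i \<in> g ` A then inv_into A g i else a) ` {..<m} = A" (is "?h ` _ = _")
  proof
    show "?h ` {..<m} \<subseteq> A"
      using a by (auto intro: inv_into_into)
    show "A \<subseteq> ?h ` {..<m}"
    proof
      fix x assume "x \<in> A"
      then show "x \<in> ?h ` {..<m}"
        using g by (intro image_eqI[of _ _ "g x"]) auto
    qed
  qed
  then show ?thesis by blast
qed

theorem theorem4p1:
  fixes M :: "'a metric" and n m :: nat and l :: real
  assumes "finite (mspace M)" and "mspace M \<noteq> {}"
    and "n = card (mspace M)"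
    and "m > n" and "l > 0"
  shows "2 * gh_dist (simplex_metric l m) M = ennreal (max l (metric_diam M - l))"
proof -
  let ?S = "simplex_metric l m" and ?c = "max l (metric_diam M - l)"
  note S = mspace_simplex_metric[OF \<open>l > 0\<close>, of m]
  have "?c > 0" using \<open>l > 0\<close> by simp
  obtain h where "h ` {..<m} = mspace M"
    using ex_surj_lessThan[of "mspace M" m] assms by auto
  then have "correspondence_within (2 * (?c / 2)) ?S M ((\<lambda>i. (i, h i)) ` {..<m})"
    using simplex_correspondence_surj assms by simp
  then have upper: "gh_dist ?S M \<le> ennreal (?c / 2)"
    by (rule gh_dist_le_if_correspondence) (use \<open>?c > 0\<close> in simp)
  have lower: "ennreal (?c / 2) \<le> gh_dist ?S M"
    unfolding gh_dist_def
  proof (rule Inf_greatest, clarify)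
    fix Z :: "(nat + 'a) metric" and f g
    assume emb: "isometric_embedding ?S Z f" "isometric_embedding M Z g"
    show "ennreal (?c / 2) \<le> hausdorff_dist Z (f ` mspace ?S) (g ` mspace M)"
    proof (cases "hausdorff_dist Z (f ` mspace ?S) (g ` mspace M)")
      case (real r)
      then have "correspondence_within (2 * r) ?S M
          {(x, y) \<in> mspace ?S \<times> mspace M. mdist Z (f x) (g y) \<le> r}"
        using assms by (intro correspondence_if_hausdorff_dist_le[OF emb]) (auto simp: S)
      then have "?c \<le> 2 * r"
        using assms by (intro simplex_correspondence_lower) auto
      then show ?thesis
        unfolding real by (intro ennreal_leI) simp
    next
      case top
      then show ?thesis by simp
    qed
  qed
  from upper lower have "gh_dist ?S M = ennreal (?c / 2)"
    by (rule antisym)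
  moreover have "2 * ennreal (?c / 2) = ennreal (2 * (?c / 2))"
    using \<open>?c > 0\<close> by (simp only: ennreal_mult' ennreal_numeral)
  ultimately show ?thesis by simp
qed

end
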